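(* Let $1\le p\le 2$ and let $\mathbb{B}$ be a separable Banach space of type $p$, with a constant $C$ such that $\mathbb{E}\left(\left\|\sum_{i=0}^nY_i\right\|^p\right)\le C\sum_{i=0}^n\mathbb{E}(\|Y_i\|^p)$ for all $n$ and all independent $\mathbb{B}$-valued random variables $Y_0,\dots,Y_n$ with expectation $0$ and finite $p$-th moment. Let $(X_n)$ be a sequence of independent $\mathbb{B}$-valued random variables each with expected value $0$, and let $\phi_0(t)=t^p$ for $0\le t\le 1$ and $\phi_0(t)=t$ for $t>1$. Suppose the real sequence $\sum_{i=0}^n\mathbb{E}(\phi_0(\|X_i\|))$ converges with rate of Cauchy metastability $\Phi$. Then $S_n:=\sum_{i=0}^nX_i$ converges almost surely with rate of metastable almost sure convergence $$\Delta_\Phi(\varepsilon,\lambda,K):=\Phi(\tilde\varepsilon,K),\qquad \tilde\varepsilon:=\min\left\{\frac{\varepsilon\lambda}{6},\ \frac{\lambda\varepsilon^p}{2^{3p-1}\cdot 3C},\ \left(\frac{\lambda\varepsilon^p}{2^{2p-1}\cdot 3}\right)^{1/p}\right\}.$$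
   Context: Random variables are tight Borel measurable maps from a probability space into $\mathbb{B}$; expectation of $\mathbb{B}$-valued variables is the Bochner integral. $[a;b]:=\{a,\dots,b\}$ (empty if $a>b$). $\Phi:\mathbb{Q}^+\times(\mathbb{N}\to\mathbb{N})\to\mathbb{N}$ is a rate of Cauchy metastability for a real sequence $(t_n)$ if for all $\varepsilon,g$ there is $N\le\Phi(\varepsilon,g)$ with $|t_n-t_m|<\varepsilon$ for all $n,m\in[N;N+g(N)]$. $\Delta$ is a rate of metastable almost sure (Cauchy) convergence for $(S_n)$ if for all $\varepsilon,\lambda\in\mathbb{Q}^+$ and $K:\mathbb{N}\to\mathbb{N}$ there is $N\le\Delta(\varepsilon,\lambda,K)$ with $\mathbb{P}\left(\max_{N\le n\le N+K(N)}\|S_N-S_n\|\ge\varepsilon\right)<\lambda$.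
   Formalization: The rate Φ is taken on positive real (not only rational) precisions, since ε̃ may be irrational and Φ(ε̃,K) would be undefined; ε and λ also range over positive reals; C > 0 is assumed so that ε̃ is defined and positive (this can fail only for the zero space). *)

theory Defs
  imports "HOL-Probability.Probability"
begin

text \<open>
  Random variables are assumed to be Borel measurable only: in a separable Banach space
  tightness is automatic.
\<close>

lemma (in prob_space) borel_random_variable_tight:
  fixes X :: "'a \<Rightarrow> 'b::{complete_space, second_countable_topology}"
  assumes X: "random_variable borel X" and "e > 0"
  obtains K where "compact K" "prob {\<omega> \<in> space M. X \<omega> \<notin> K} < e"
proof -
  let ?D = "distr M borel X"
  interpret D: prob_space ?D by (rule prob_space_distr[OF X])
  have "(SUP K \<in> {K. compact K}. emeasure ?D K) = 1"
    using inner_regular[of ?D UNIV] D.emeasure_space_1 by simp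
  moreover have "ennreal (1 - e) < 1"
    using \<open>e > 0\<close> by (simp add: ennreal_less_one_iff)
  ultimately have "ennreal (1 - e) < (SUP K \<in> {K. compact K}. emeasure ?D K)"
    by simp
  then obtain K where K: "compact K" "ennreal (1 - e) < emeasure ?D K"
    unfolding less_SUP_iff by blast
  have m: "K \<in> sets borel" using K(1) by (simp add: borel_compact)
  have "1 - e < D.prob K"
    using K(2) by (simp add: D.emeasure_eq_measure ennreal_less_iff ennreal_lessI)
      (metis D.emeasure_eq_measure K(2) ennreal_leI linorder_not_less)
  also have "D.prob K = prob (X -` K \<inter> space M)"
    using m by (simp add: measure_distr[OF X])
  finally have 1: "1 - e < prob (X -` K \<inter> space M)" .
  have "X -` K \<inter> space M \<in> events" using X m by measurable
  from prob_compl[OF this] have "prob (space M - (X -` K \<inter> space M)) < e" using 1 by simp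
  also have "space M - (X -` K \<inter> space M) = {\<omega> \<in> space M. X \<omega> \<notin> K}" by auto
  finally show ?thesis using that K(1) by blast
qed

text \<open>
  Type \<open>p\<close> in the Rademacher sense: the left-hand side is the \<open>p\<close>-th moment of the norm of
  \<open>\<epsilon>\<^sub>0 x\<^sub>0 + \<dots> + \<epsilon>\<^sub>n x\<^sub>n\<close> for independent symmetric signs \<open>\<epsilon>\<^sub>i\<close>, written as an average over all
  sign patterns.
\<close>

definition rademacher_type :: "'b::real_normed_vector itself \<Rightarrow> real \<Rightarrow> bool" where
  "rademacher_type _ p \<longleftrightarrow>
     (\<exists>C. \<forall>n (x :: nat \<Rightarrow> 'b).
        (\<Sum>s\<in>{..n} \<rightarrow>\<^sub>E {-1, 1::real}. norm (\<Sum>i\<le>n. s i *\<^sub>R x i) powr p) / 2 ^ (n + 1)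
          \<le> C * (\<Sum>i\<le>n. norm (x i) powr p))"

text \<open>
  The inequality below is meant for independent random variables on an arbitrary probability
  space. HOL cannot quantify over the type of the sample points; the sample points are
  therefore taken in \<open>nat \<Rightarrow> 'b\<close>, which suffices because that type carries the joint law of any
  \<open>Y\<^sub>0, \<dots>, Y\<^sub>n\<close>. The lemma \<open>type_constantD\<close> gives back the inequality on every probability space.
\<close>

definition type_constant ::
    "'b::{banach, second_countable_topology} itself \<Rightarrow> real \<Rightarrow> real \<Rightarrow> bool" where
  "type_constant _ p C \<longleftrightarrow>
     (\<forall>(M :: (nat \<Rightarrow> 'b) measure) n (Y :: nat \<Rightarrow> (nat \<Rightarrow> 'b) \<Rightarrow> 'b).
        prob_space M \<longrightarrow>
        prob_space.indep_vars M (\<lambda>_. borel) Y {..n} \<longrightarrow>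
        (\<forall>i\<le>n. integrable M (Y i) \<and> integral\<^sup>L M (Y i) = 0 \<and>
               integrable M (\<lambda>\<omega>. norm (Y i \<omega>) powr p)) \<longrightarrow>
        (\<integral>\<omega>. norm (\<Sum>i\<le>n. Y i \<omega>) powr p \<partial>M)
          \<le> C * (\<Sum>i\<le>n. \<integral>\<omega>. norm (Y i \<omega>) powr p \<partial>M))"

lemma (in prob_space) type_constantD:
  fixes Y :: "nat \<Rightarrow> 'a \<Rightarrow> 'b::{banach, second_countable_topology}"
  assumes C: "type_constant TYPE('b) p C"
    and ind: "indep_vars (\<lambda>_. borel) Y {..n}"
    and int: "\<And>i. i \<le> n \<Longrightarrow> integrable M (Y i)"
    and zero: "\<And>i. i \<le> n \<Longrightarrow> expectation (Y i) = 0"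
    and mom: "\<And>i. i \<le> n \<Longrightarrow> integrable M (\<lambda>\<omega>. norm (Y i \<omega>) powr p)"
  shows "expectation (\<lambda>\<omega>. norm (\<Sum>i\<le>n. Y i \<omega>) powr p)
           \<le> C * (\<Sum>i\<le>n. expectation (\<lambda>\<omega>. norm (Y i \<omega>) powr p))"
proof -
  let ?P = "Pi\<^sub>M {..n} (\<lambda>_. borel :: 'b measure)"
  let ?f = "\<lambda>\<omega>. \<lambda>i\<in>{..n}. Y i \<omega>"
  let ?D = "distr M ?P ?f"
  have rv: "random_variable borel (Y i)" if "i \<le> n" for i
    using ind that by (auto simp: indep_vars_def)
  have f: "?f \<in> measurable M ?P" by (rule measurable_restrict) (simp add: rv)
  have co: "(\<lambda>x. x i) \<in> measurable ?P borel" if "i \<le> n" for i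
    using that by (intro measurable_component_singleton) simp
  interpret D: prob_space ?D by (rule prob_space_distr[OF f])
  have marg: "distr ?D borel (\<lambda>x. x i) = distr M borel (Y i)" if "i \<le> n" for i
    using that by (subst distr_distr[OF co f]) (auto intro!: distr_cong)
  have "distr ?D ?P (\<lambda>x. \<lambda>i\<in>{..n}. x i) = distr ?D ?P (\<lambda>x. x)"
    by (intro distr_cong) (auto simp: space_PiM)
  also have "\<dots> = ?D" by (simp add: distr_id2)
  also have "\<dots> = Pi\<^sub>M {..n} (\<lambda>i. distr M borel (Y i))"
    using ind by (subst (asm) indep_vars_iff_distr_eq_PiM') (auto simp: rv)
  also have "\<dots> = Pi\<^sub>M {..n} (\<lambda>i. distr ?D borel (\<lambda>x. x i))"
    by (intro PiM_cong) (auto simp: marg)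
  finally have "D.indep_vars (\<lambda>_. borel) (\<lambda>i x. x i) {..n}"
    by (subst D.indep_vars_iff_distr_eq_PiM') (auto simp: co)
  moreover have "integrable ?D (\<lambda>x. x i)" "integral\<^sup>L ?D (\<lambda>x. x i) = 0"
      "integrable ?D (\<lambda>x. norm (x i) powr p)" if "i \<le> n" for i
  proof -
    have m: "(\<lambda>x. norm (x i) powr p) \<in> borel_measurable ?P"
      using co[OF that] by measurable
    show "integrable ?D (\<lambda>x. x i)"
      using int[OF that] that by (subst integrable_distr_eq[OF f co[OF that]]) simp
    show "integral\<^sup>L ?D (\<lambda>x. x i) = 0"
      using zero[OF that] that by (subst integral_distr[OF f co[OF that]]) simp
    show "integrable ?D (\<lambda>x. norm (x i) powr p)"
      using mom[OF that] that by (subst integrable_distr_eq[OF f m]) simp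
  qed
  ultimately have *: "(\<integral>x. norm (\<Sum>i\<le>n. x i) powr p \<partial>?D)
      \<le> C * (\<Sum>i\<le>n. \<integral>x. norm (x i) powr p \<partial>?D)"
    using C D.prob_space_axioms unfolding type_constant_def by blast
  have "(\<lambda>x. norm (\<Sum>i\<le>n. x i) powr p) \<in> borel_measurable ?P"
    using co by measurable
  then have "(\<integral>x. norm (\<Sum>i\<le>n. x i) powr p \<partial>?D) = expectation (\<lambda>\<omega>. norm (\<Sum>i\<le>n. Y i \<omega>) powr p)"
    by (subst integral_distr[OF f]) auto
  moreover have "(\<integral>x. norm (x i) powr p \<partial>?D) = expectation (\<lambda>\<omega>. norm (Y i \<omega>) powr p)"
    if "i \<le> n" for i
  proof -
    have m: "(\<lambda>x. norm (x i) powr p) \<in> borel_measurable ?P"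
      using co[OF that] by measurable
    show ?thesis using that by (subst integral_distr[OF f m]) simp
  qed
  ultimately show ?thesis using * by simp
qed

lemma type_constant_imp_rademacher_type:
  assumes C: "type_constant TYPE('b::{banach, second_countable_topology}) p C"
  shows "rademacher_type TYPE('b) p"
  unfolding rademacher_type_def
proof (intro exI[of _ C] allI)
  fix n :: nat and x :: "nat \<Rightarrow> 'b"
  let ?S = "{..n} \<rightarrow>\<^sub>E {-1, 1::real}"
  let ?q = "Pi_pmf {..n} undefined (\<lambda>_. pmf_of_set {-1, 1::real})"
  have eq: "PiE_dflt {..n} undefined (\<lambda>_. {-1, 1::real}) = ?S"
    by (auto simp: PiE_dflt_def PiE_iff extensional_def)
  have q: "?q = pmf_of_set ?S"
    by (subst Pi_pmf_of_set) (auto simp: eq)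
  have fin: "finite ?S" by (intro finite_PiE) auto
  have ne: "?S \<noteq> {}" by (simp add: PiE_eq_empty_iff)
  have card: "card ?S = 2 ^ (n + 1)" by (subst card_PiE) (auto simp: card_insert_if numeral_2_eq_2)
  have finq: "finite (set_pmf ?q)" unfolding q using fin ne by simp
  have ind: "prob_space.indep_vars (measure_pmf ?q) (\<lambda>_. borel) (\<lambda>i s. s i *\<^sub>R x i) {..n}"
    by (rule prob_space.indep_vars_compose2[OF measure_pmf.prob_space_axioms indep_vars_Pi_pmf]) auto
  have mean: "measure_pmf.expectation ?q (\<lambda>s. s i *\<^sub>R x i) = 0" if "i \<le> n" for i
  proof -
    have "measure_pmf.expectation ?q (\<lambda>s. s i)
        = measure_pmf.expectation (map_pmf (\<lambda>s. s i) ?q) (\<lambda>y. y)"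
      by simp
    also have "map_pmf (\<lambda>s. s i) ?q = pmf_of_set {-1, 1}"
      using that by (subst Pi_pmf_component) auto
    also have "measure_pmf.expectation \<dots> (\<lambda>y. y) = (0::real)"
      by (subst integral_pmf_of_set) auto
    finally show ?thesis
      using finq by (subst integral_scaleR_left) (auto intro: integrable_measure_pmf_finite)
  qed
  have norms: "measure_pmf.expectation ?q (\<lambda>s. norm (s i *\<^sub>R x i) powr p) = norm (x i) powr p"
    if "i \<le> n" for i
  proof -
    have "measure_pmf.expectation ?q (\<lambda>s. norm (s i *\<^sub>R x i) powr p)
        = measure_pmf.expectation ?q (\<lambda>s. norm (x i) powr p)"
    proof (intro integral_cong_AE, goal_cases)
      case 3
      have "\<bar>s i\<bar> = 1" if "s \<in> ?S" for s
        using PiE_mem[OF that, of i] \<open>i \<le> n\<close> by auto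
      then show ?case
        unfolding AE_measure_pmf_iff q set_pmf_of_set[OF ne fin] by simp
    qed simp_all
    then show ?thesis by simp
  qed
  have "measure_pmf.expectation ?q (\<lambda>s. norm (\<Sum>i\<le>n. s i *\<^sub>R x i) powr p)
      \<le> C * (\<Sum>i\<le>n. measure_pmf.expectation ?q (\<lambda>s. norm (s i *\<^sub>R x i) powr p))"
    by (rule prob_space.type_constantD[OF measure_pmf.prob_space_axioms C ind])
      (auto intro: integrable_measure_pmf_finite finq mean)
  also have "(\<Sum>i\<le>n. measure_pmf.expectation ?q (\<lambda>s. norm (s i *\<^sub>R x i) powr p))
      = (\<Sum>i\<le>n. norm (x i) powr p)"
    by (intro sum.cong refl norms) simp
  also have "measure_pmf.expectation ?q (\<lambda>s. norm (\<Sum>i\<le>n. s i *\<^sub>R x i) powr p)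
      = (\<Sum>s\<in>?S. norm (\<Sum>i\<le>n. s i *\<^sub>R x i) powr p) / 2 ^ (n + 1)"
    unfolding q by (subst integral_pmf_of_set[OF ne fin]) (simp add: card)
  finally show "(\<Sum>s\<in>?S. norm (\<Sum>i\<le>n. s i *\<^sub>R x i) powr p) / 2 ^ (n + 1)
      \<le> C * (\<Sum>i\<le>n. norm (x i) powr p)" .
qed

definition phi0 :: "real \<Rightarrow> real \<Rightarrow> real" where
  "phi0 p t = (if t \<le> 1 then t powr p else t)"

text \<open>
  Rates take positive real precisions rather than positive rational ones, since they are
  evaluated at possibly irrational arguments such as \<open>\<epsilon> powr p\<close>. By the lemma
  \<open>cauchy_metastability_rate_extend\<close>, this costs no generality.
\<close>

definition cauchy_metastability_rate ::
    "(real \<Rightarrow> (nat \<Rightarrow> nat) \<Rightarrow> nat) \<Rightarrow> (nat \<Rightarrow> real) \<Rightarrow> bool" where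
  "cauchy_metastability_rate \<Phi> t \<longleftrightarrow>
     (\<forall>\<epsilon>>0. \<forall>g. \<exists>N\<le>\<Phi> \<epsilon> g. \<forall>n\<in>{N..N + g N}. \<forall>m\<in>{N..N + g N}. \<bar>t n - t m\<bar> < \<epsilon>)"

lemma cauchy_metastability_rate_extend:
  assumes "\<And>\<epsilon> g. \<epsilon> \<in> \<rat> \<Longrightarrow> \<epsilon> > 0 \<Longrightarrow>
             \<exists>N\<le>\<Phi> \<epsilon> g. \<forall>n\<in>{N..N + g N}. \<forall>m\<in>{N..N + g N}. \<bar>t n - t m\<bar> < \<epsilon>"
  obtains \<Psi> where "cauchy_metastability_rate \<Psi> t" "\<And>\<epsilon>. \<epsilon> \<in> \<rat> \<Longrightarrow> \<epsilon> > 0 \<Longrightarrow> \<Psi> \<epsilon> = \<Phi> \<epsilon>"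
proof -
  have "\<forall>\<epsilon>::real. \<exists>r. \<epsilon> > 0 \<longrightarrow> r \<in> \<rat> \<and> 0 < r \<and> r \<le> \<epsilon> \<and> (\<epsilon> \<in> \<rat> \<longrightarrow> r = \<epsilon>)"
  proof
    fix \<epsilon> :: real
    show "\<exists>r. \<epsilon> > 0 \<longrightarrow> r \<in> \<rat> \<and> 0 < r \<and> r \<le> \<epsilon> \<and> (\<epsilon> \<in> \<rat> \<longrightarrow> r = \<epsilon>)"
      using Rats_dense_in_real[of 0 \<epsilon>] by (cases "\<epsilon> \<in> \<rat>") (auto intro: less_imp_le)
  qed
  then obtain r where r: "\<And>\<epsilon>::real. \<epsilon> > 0 \<Longrightarrow> r \<epsilon> \<in> \<rat> \<and> 0 < r \<epsilon> \<and> r \<epsilon> \<le> \<epsilon> \<and> (\<epsilon> \<in> \<rat> \<longrightarrow> r \<epsilon> = \<epsilon>)"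
    by metis
  show ?thesis
  proof (rule that[of "\<lambda>\<epsilon>. \<Phi> (r \<epsilon>)"])
    show "cauchy_metastability_rate (\<lambda>\<epsilon>. \<Phi> (r \<epsilon>)) t"
      unfolding cauchy_metastability_rate_def
    proof (intro allI impI)
      fix \<epsilon> :: real and g :: "nat \<Rightarrow> nat"
      assume e: "\<epsilon> > 0"
      with assms[of "r \<epsilon>" g] r[OF e] obtain N where "N \<le> \<Phi> (r \<epsilon>) g"
        "\<forall>n\<in>{N..N + g N}. \<forall>m\<in>{N..N + g N}. \<bar>t n - t m\<bar> < r \<epsilon>" by blast
      then show "\<exists>N\<le>\<Phi> (r \<epsilon>) g. \<forall>n\<in>{N..N + g N}. \<forall>m\<in>{N..N + g N}. \<bar>t n - t m\<bar> < \<epsilon>"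
        using r[OF e] by (meson less_le_trans)
    qed
  qed (simp add: r)
qed

definition metastable_as_rate ::
    "'a measure \<Rightarrow> (real \<Rightarrow> real \<Rightarrow> (nat \<Rightarrow> nat) \<Rightarrow> nat) \<Rightarrow>
     (nat \<Rightarrow> 'a \<Rightarrow> 'b::real_normed_vector) \<Rightarrow> bool" where
  "metastable_as_rate M \<Delta> S \<longleftrightarrow>
     (\<forall>\<epsilon>>0. \<forall>\<delta>>0. \<forall>K. \<exists>N\<le>\<Delta> \<epsilon> \<delta> K.
        measure M {\<omega> \<in> space M. (MAX n\<in>{N..N + K N}. norm (S N \<omega> - S n \<omega>)) \<ge> \<epsilon>} < \<delta>)"

definition eps_tilde :: "real \<Rightarrow> real \<Rightarrow> real \<Rightarrow> real \<Rightarrow> real" where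
  "eps_tilde p C \<epsilon> \<delta> =
     Min {\<epsilon> * \<delta> / 6,
          \<delta> * \<epsilon> powr p / (2 powr (3 * p - 1) * (3 * C)),
          (\<delta> * \<epsilon> powr p / (2 powr (2 * p - 1) * 3)) powr (1 / p)}"

end

theory Submission
  imports Defs
begin

text \<open>
  Truncate each \<open>X\<^sub>i\<close> at norm 1, \<open>X\<^sub>i = Y\<^sub>i + Z\<^sub>i\<close>, so that
  \<open>E \<phi>\<^sub>0(\<parallel>X\<^sub>i\<parallel>) = E \<parallel>Y\<^sub>i\<parallel>\<^sup>p + E \<parallel>Z\<^sub>i\<parallel>\<close>, and center both parts. Doob's maximal inequality
  for \<open>\<parallel>\<cdot>\<parallel>\<^sup>p\<close> together with type \<open>p\<close> controls the sums of the \<open>Y\<^sub>i - E Y\<^sub>i\<close>, and Markov's inequality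
  controls the sum of the \<open>\<parallel>Z\<^sub>i - E Z\<^sub>i\<parallel>\<close>. Since \<open>\<parallel>E Y\<^sub>i\<parallel>\<^sup>p \<le> E \<parallel>Y\<^sub>i\<parallel>\<^sup>p\<close> by Jensen, the probability
  that \<open>\<parallel>S\<^sub>n - S\<^sub>N\<parallel> \<ge> \<epsilon>\<close> for some \<open>n\<close> with \<open>N < n \<le> m\<close> is at most \<open>max (4 / \<epsilon>) (4\<^sup>p C / \<epsilon>\<^sup>p)\<close> times
  the sum of the \<open>E \<phi>\<^sub>0(\<parallel>X\<^sub>i\<parallel>)\<close> over \<open>N < i \<le> m\<close>.
\<close>

section \<open>Convexity of \<open>t powr p\<close>\<close>

lemma powr_above_tangent:
  fixes a b p :: real
  assumes "1 \<le> p" "0 < a" "0 \<le> b"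
  shows "a powr p + p * a powr (p - 1) * (b - a) \<le> b powr p"
proof (cases "b = 0")
  case True
  have "a powr p = a powr (p - 1) * a"
    using assms by (simp add: powr_diff)
  then have "a powr p + p * a powr (p - 1) * (b - a) = (1 - p) * a powr p"
    using True by (simp add: algebra_simps)
  also have "\<dots> \<le> 0" using assms by (simp add: mult_nonpos_nonneg)
  finally show ?thesis using True by simp
next
  case False
  have "b powr p - a powr p \<ge> p * a powr (p - 1) * (b - a)"
  \<comment> \<open>The tangent rule is applied on the open half-line, where the power is
    differentiable; the endpoint \<open>b = 0\<close> is the case computed by hand above.\<close>
  proof (rule convex_on_imp_above_tangent[where A = "{0<..}"])
    show "convex_on {0<..} (\<lambda>x::real. x powr p)" using assms by (intro powr_convex)
    show "((\<lambda>x. x powr p) has_field_derivative p * a powr (p - 1)) (at a within {0<..})"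
      using has_real_derivative_powr[OF \<open>0 < a\<close>, of p] by (rule has_field_derivative_at_within)
  qed (use assms False in \<open>auto simp: interior_open\<close>)
  then show ?thesis by simp
qed

text \<open>Midpoint convexity: add the tangent inequalities at \<open>m = (u + v) / 2\<close> for
  the points \<open>u\<close> and \<open>v\<close>. The slope terms cancel, leaving twice
  \<open>m powr p\<close> below the sum of the two powers. The tangent needs a positive base point,
  so \<open>u + v = 0\<close> is treated apart.\<close>

lemma powr_add_le:
  fixes u v p :: real
  assumes "1 \<le> p" "0 \<le> u" "0 \<le> v"
  shows "(u + v) powr p \<le> 2 powr (p - 1) * (u powr p + v powr p)"
proof (cases "u + v = 0")
  case True
  then show ?thesis using assms by simp
next
  case False
  define m where "m = (u + v) / 2"
  have m: "m > 0" "u + v = 2 * m" using False assms by (auto simp: m_def)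
  have "2 * m powr p = m powr p + p * m powr (p - 1) * (u - m) + (m powr p + p * m powr (p - 1) * (v - m))"
  proof -
    have v: "v = 2 * m - u" using m(2) by simp
    show ?thesis unfolding v by (simp add: algebra_simps)
  qed
  also have "\<dots> \<le> u powr p + v powr p"
    using assms m by (intro add_mono powr_above_tangent) auto
  finally have "2 powr (p - 1) * (2 * m powr p) \<le> 2 powr (p - 1) * (u powr p + v powr p)"
    by (intro mult_left_mono) auto
  then show ?thesis
    using m by (simp add: powr_mult powr_diff)
qed

section \<open>Jensen's and Doob's inequalities for powers of the norm\<close>

context prob_space
begin

text \<open>Jensen's inequality, by integrating the tangent at \<open>norm (expectation X)\<close>
  evaluated at \<open>norm (X \<omega>)\<close>. The nonnegative integral on the right also covers
  variables whose \<open>p\<close>-th moment is infinite.\<close>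

lemma norm_expectation_powr_le:
  fixes X :: "'a \<Rightarrow> 'b::{banach, second_countable_topology}"
  assumes "1 \<le> p" and X: "integrable M X"
  shows "ennreal (norm (expectation X) powr p) \<le> (\<integral>\<^sup>+\<omega>. ennreal (norm (X \<omega>) powr p) \<partial>M)"
proof (cases "expectation X = 0 \<or> (\<integral>\<^sup>+\<omega>. ennreal (norm (X \<omega>) powr p) \<partial>M) = \<infinity>")
  case True
  then show ?thesis by auto
next
  case False
  let ?a = "norm (expectation X)"
  have [measurable]: "X \<in> borel_measurable M" using X by auto
  have int: "integrable M (\<lambda>\<omega>. norm (X \<omega>) powr p)"
    using False by (intro integrableI_nonneg) (auto simp: top.not_eq_extremum)
  \<comment> \<open>The factor 0 is there to be enlarged to
    \<open>expectation (\<lambda>\<omega>. norm (X \<omega>)) - ?a\<close>, which is nonnegative by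
    the triangle inequality for integrals.\<close>
  have "?a powr p + p * ?a powr (p - 1) * 0
      \<le> ?a powr p + p * ?a powr (p - 1) * (expectation (\<lambda>\<omega>. norm (X \<omega>)) - ?a)"
    using assms by (intro add_left_mono mult_left_mono) auto
  also have "\<dots> = expectation (\<lambda>\<omega>. ?a powr p + p * ?a powr (p - 1) * (norm (X \<omega>) - ?a))"
    using X by (simp add: prob_space)
  also have "\<dots> \<le> expectation (\<lambda>\<omega>. norm (X \<omega>) powr p)"
    using X int False assms by (intro integral_mono powr_above_tangent) auto
  finally show ?thesis
    by (simp add: nn_integral_eq_integral[OF int] ennreal_leI)
qed

text \<open>The submartingale property of the \<open>p\<close>-th power of the norm, with Fubini's theorem in
  place of a conditional expectation.\<close>

lemma nn_integral_norm_powr_add_indep: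
  fixes u r :: "'c \<Rightarrow> 'b::{banach, second_countable_topology}"
  assumes "1 \<le> p" and ind: "indep_var N V N' V'"
    and r: "integrable M (\<lambda>\<omega>. r (V' \<omega>))" "expectation (\<lambda>\<omega>. r (V' \<omega>)) = 0"
    and [measurable]: "u \<in> borel_measurable N" "r \<in> borel_measurable N'" "B \<in> sets N"
  shows "(\<integral>\<^sup>+\<omega>. indicator B (V \<omega>) * ennreal (norm (u (V \<omega>)) powr p) \<partial>M)
       \<le> (\<integral>\<^sup>+\<omega>. indicator B (V \<omega>) * ennreal (norm (u (V \<omega>) + r (V' \<omega>)) powr p) \<partial>M)"
proof -
  have [measurable]: "random_variable N V" "random_variable N' V'"
    and D: "distr M N V \<Otimes>\<^sub>M distr M N' V' = distr M (N \<Otimes>\<^sub>M N') (\<lambda>\<omega>. (V \<omega>, V' \<omega>))"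
    using ind unfolding indep_var_distribution_eq by auto
  interpret V': prob_space "distr M N' V'" by (rule prob_space_distr) measurable
  \<comment> \<open>Jensen for the translate by a fixed \<open>x\<close>, whose mean is
    \<open>x\<close> because \<open>r\<close> is centered; integrating over \<open>x = u v\<close>
    on \<open>B\<close> then gives the claim.\<close>
  have le: "ennreal (norm x powr p) \<le> (\<integral>\<^sup>+w. ennreal (norm (x + r w) powr p) \<partial>distr M N' V')" for x
  proof -
    have "expectation (\<lambda>\<omega>. x + r (V' \<omega>)) = x" using r by (simp add: prob_space)
    then have "ennreal (norm x powr p) \<le> (\<integral>\<^sup>+\<omega>. ennreal (norm (x + r (V' \<omega>)) powr p) \<partial>M)"
      using norm_expectation_powr_le[of p "\<lambda>\<omega>. x + r (V' \<omega>)"] assms by auto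
    then show ?thesis by (simp add: nn_integral_distr)
  qed
  have "(\<integral>\<^sup>+\<omega>. indicator B (V \<omega>) * ennreal (norm (u (V \<omega>)) powr p) \<partial>M)
      = (\<integral>\<^sup>+v. indicator B v * ennreal (norm (u v) powr p) \<partial>distr M N V)"
    by (simp add: nn_integral_distr)
  also have "\<dots> \<le> (\<integral>\<^sup>+v. indicator B v * (\<integral>\<^sup>+w. ennreal (norm (u v + r w) powr p) \<partial>distr M N' V') \<partial>distr M N V)"
    by (intro nn_integral_mono mult_left_mono le) auto
  also have "\<dots> = (\<integral>\<^sup>+v. (\<integral>\<^sup>+w. indicator B v * ennreal (norm (u v + r w) powr p) \<partial>distr M N' V') \<partial>distr M N V)"
    by (intro nn_integral_cong nn_integral_cmult[symmetric]) auto
  also have "\<dots> = (\<integral>\<^sup>+z. indicator B (fst z) * ennreal (norm (u (fst z) + r (snd z)) powr p)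
      \<partial>(distr M N V \<Otimes>\<^sub>M distr M N' V'))"
    by (subst V'.nn_integral_fst[symmetric]) auto
  also have "\<dots> = (\<integral>\<^sup>+\<omega>. indicator B (V \<omega>) * ennreal (norm (u (V \<omega>) + r (V' \<omega>)) powr p) \<partial>M)"
    unfolding D by (subst nn_integral_distr) auto
  finally show ?thesis .
qed

text \<open>Doob's argument: split the event according to the first \<open>k\<close> at which the
  partial sum reaches \<open>c\<close>. On \<open>A k\<close> the power of
  \<open>norm (T k \<omega>)\<close> is at least \<open>c powr p\<close>. Since \<open>A k\<close>
  depends on \<open>W 0\<close> to \<open>W k\<close> only, passing from \<open>T k\<close> to
  \<open>T n\<close> adds an independent centered remainder and cannot decrease the integral over
  \<open>A k\<close>. The \<open>A k\<close> are disjoint, so these integrals add up to at most the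
  full one.\<close>

lemma maximal_inequality_norm_powr:
  fixes W :: "nat \<Rightarrow> 'a \<Rightarrow> 'b::{banach, second_countable_topology}"
  assumes "1 \<le> p" and c: "0 < c" and ind: "indep_vars (\<lambda>_. borel) W {..n}"
    and W: "\<And>i. i \<le> n \<Longrightarrow> integrable M (W i)" "\<And>i. i \<le> n \<Longrightarrow> expectation (W i) = 0"
  shows "ennreal (c powr p) * emeasure M {\<omega> \<in> space M. \<exists>k\<le>n. c \<le> norm (\<Sum>i\<le>k. W i \<omega>)}
       \<le> (\<integral>\<^sup>+\<omega>. ennreal (norm (\<Sum>i\<le>n. W i \<omega>) powr p) \<partial>M)"
proof -
  have Wm: "W i \<in> borel_measurable M" if "i \<le> n" for i
    using W(1)[OF that] by auto
  define T where "T k \<omega> = (\<Sum>i\<le>k. W i \<omega>)" for k \<omega>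
  define A where "A k = {\<omega> \<in> space M. c \<le> norm (T k \<omega>) \<and> (\<forall>j<k. norm (T j \<omega>) < c)}" for k
  have T: "T k \<in> borel_measurable M" if "k \<le> n" for k
    using that unfolding T_def by (intro borel_measurable_sum Wm) auto
  have T': "(\<lambda>\<omega>. norm (T k \<omega>)) \<in> borel_measurable M" if "k \<le> n" for k
    using T[OF that] by measurable
  have A: "A k \<in> sets M" if "k \<le> n" for k
  proof -
    have "{\<omega> \<in> space M. \<forall>j\<in>{..<k}. norm (T j \<omega>) < c} \<in> sets M"
      using that by (intro sets.sets_Collect_finite_All) (auto intro!: borel_measurable_less T')
    moreover have "{\<omega> \<in> space M. c \<le> norm (T k \<omega>)} \<in> sets M"
      using that by (intro borel_measurable_le T') auto
    moreover have "A k = {\<omega> \<in> space M. c \<le> norm (T k \<omega>)} \<inter> {\<omega> \<in> space M. \<forall>j\<in>{..<k}. norm (T j \<omega>) < c}"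
      by (auto simp: A_def)
    ultimately show ?thesis by auto
  qed
  have disj: "disjoint_family_on A {..n}"
    unfolding disjoint_family_on_def
  proof safe
    fix j k \<omega> assume "j \<noteq> k" "\<omega> \<in> A j" "\<omega> \<in> A k"
    then show "\<omega> \<in> {}" by (cases j k rule: linorder_cases) (auto simp: A_def not_le[symmetric])
  qed
  have Un: "{\<omega> \<in> space M. \<exists>k\<le>n. c \<le> norm (T k \<omega>)} = (\<Union>k\<le>n. A k)"
  proof safe
    fix \<omega> k assume \<omega>: "\<omega> \<in> space M" and k: "k \<le> n" "c \<le> norm (T k \<omega>)"
    define j where "j = (LEAST j. c \<le> norm (T j \<omega>))"
    have "c \<le> norm (T j \<omega>)" "j \<le> k" "\<And>i. i < j \<Longrightarrow> \<not> c \<le> norm (T i \<omega>)"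
      unfolding j_def using k(2) by (auto intro: LeastI Least_le dest: not_less_Least)
    then show "\<omega> \<in> (\<Union>k\<le>n. A k)" using k \<omega> by (intro UN_I[of j]) (auto simp: A_def not_le)
  qed (auto simp: A_def)
  have step: "(\<integral>\<^sup>+\<omega>. indicator (A k) \<omega> * ennreal (norm (T k \<omega>) powr p) \<partial>M)
      \<le> (\<integral>\<^sup>+\<omega>. indicator (A k) \<omega> * ennreal (norm (T n \<omega>) powr p) \<partial>M)" if k: "k \<le> n" for k
  proof -
    let ?N = "Pi\<^sub>M {..k} (\<lambda>_. borel :: 'b measure)" and ?N' = "Pi\<^sub>M {k<..n} (\<lambda>_. borel :: 'b measure)"
    let ?V = "\<lambda>\<omega>. restrict (\<lambda>i. W i \<omega>) {..k}" and ?V' = "\<lambda>\<omega>. restrict (\<lambda>i. W i \<omega>) {k<..n}"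
    let ?R = "\<lambda>\<omega>. \<Sum>i\<in>{k<..n}. W i \<omega>"
    let ?u = "\<lambda>j v. \<Sum>i\<le>j. v i :: 'b"
    \<comment> \<open>The event \<open>A k\<close> expressed in the coordinates up to
      \<open>k\<close>, so that its indicator becomes a function of the block \<open>?V\<close> that
      is independent of \<open>?V'\<close>.\<close>
    let ?B = "{v \<in> space ?N. c \<le> norm (?u k v) \<and> (\<forall>j\<in>{..<k}. norm (?u j v) < c)}"
    have u: "?u j \<in> borel_measurable ?N" if "j \<le> k" for j
      using that by (intro borel_measurable_sum measurable_component_singleton) auto
    have u': "(\<lambda>v. norm (?u j v)) \<in> borel_measurable ?N" if "j \<le> k" for j
      using u[OF that] by measurable
    have B: "?B \<in> sets ?N"
      by (intro sets.sets_Collect_conj sets.sets_Collect_finite_All)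
        (auto intro!: borel_measurable_less borel_measurable_le u')
    have i: "indep_var ?N ?V ?N' ?V'"
      using k by (intro indep_var_restrict[OF ind]) auto
    have r: "(\<lambda>v. \<Sum>i\<in>{k<..n}. v i) \<in> borel_measurable ?N'"
      by (intro borel_measurable_sum measurable_component_singleton) auto
    have R: "(\<Sum>i\<in>{k<..n}. ?V' \<omega> i) = ?R \<omega>" for \<omega>
      by (intro sum.cong) auto
    have "integrable M ?R" "expectation ?R = 0" using W by auto
    then have *: "(\<integral>\<^sup>+\<omega>. indicator ?B (?V \<omega>) * ennreal (norm (?u k (?V \<omega>)) powr p) \<partial>M)
       \<le> (\<integral>\<^sup>+\<omega>. indicator ?B (?V \<omega>) * ennreal (norm (?u k (?V \<omega>) + ?R \<omega>) powr p) \<partial>M)"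
      using nn_integral_norm_powr_add_indep[OF \<open>1 \<le> p\<close> i _ _ u[OF order.refl] r B]
      unfolding R by blast
    have uV: "?u j (?V \<omega>) = T j \<omega>" if "j \<le> k" for j \<omega>
      unfolding T_def using that by (intro sum.cong) auto
    have "indicator ?B (?V \<omega>) = (indicator (A k) \<omega> :: ennreal)" if "\<omega> \<in> space M" for \<omega>
    proof -
      have "?V \<omega> \<in> space ?N" by (auto simp: space_PiM)
      then have "?V \<omega> \<in> ?B \<longleftrightarrow> \<omega> \<in> A k"
        using that uV unfolding A_def by auto
      then show ?thesis by (simp only: indicator_def)
    qed
    moreover have "T k \<omega> + ?R \<omega> = T n \<omega>" for \<omega>
    proof -
      have "{..n} = {..k} \<union> {k<..n}" using k by auto
      then show ?thesis unfolding T_def by (simp only:) (subst sum.union_disjoint, auto)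
    qed
    ultimately show ?thesis
      using * by (simp only: uV[OF order.refl] cong: nn_integral_cong)
  qed
  have "ennreal (c powr p) * emeasure M (\<Union>k\<le>n. A k) = (\<Sum>k\<le>n. ennreal (c powr p) * emeasure M (A k))"
    using disj A by (subst sum_emeasure[symmetric]) (auto simp: sum_distrib_left)
  also have "\<dots> \<le> (\<Sum>k\<le>n. \<integral>\<^sup>+\<omega>. indicator (A k) \<omega> * ennreal (norm (T n \<omega>) powr p) \<partial>M)"
  proof (intro sum_mono)
    fix k assume "k \<in> {..n}"
    then have k: "k \<le> n" by simp
    have "ennreal (c powr p) * emeasure M (A k) = (\<integral>\<^sup>+\<omega>. ennreal (c powr p) * indicator (A k) \<omega> \<partial>M)"
      using A[OF k] by (simp add: nn_integral_cmult_indicator)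
    also have "\<dots> \<le> (\<integral>\<^sup>+\<omega>. indicator (A k) \<omega> * ennreal (norm (T k \<omega>) powr p) \<partial>M)"
      using c \<open>1 \<le> p\<close> by (intro nn_integral_mono) (auto simp: A_def indicator_def intro!: ennreal_leI powr_mono2)
    also note step[OF k]
    finally show "ennreal (c powr p) * emeasure M (A k)
        \<le> (\<integral>\<^sup>+\<omega>. indicator (A k) \<omega> * ennreal (norm (T n \<omega>) powr p) \<partial>M)" .
  qed
  also have "\<dots> = (\<integral>\<^sup>+\<omega>. (\<Sum>k\<le>n. indicator (A k) \<omega> * ennreal (norm (T n \<omega>) powr p)) \<partial>M)"
  proof (intro nn_integral_sum[symmetric])
    fix k assume "k \<in> {..n}"
    then have [measurable]: "A k \<in> sets M" "T n \<in> borel_measurable M"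
      using A T by auto
    show "(\<lambda>\<omega>. indicator (A k) \<omega> * ennreal (norm (T n \<omega>) powr p)) \<in> borel_measurable M"
      by measurable
  qed
  also have "\<dots> \<le> (\<integral>\<^sup>+\<omega>. ennreal (norm (T n \<omega>) powr p) \<partial>M)"
  proof (intro nn_integral_mono)
    fix \<omega>
    have "(\<Sum>k\<le>n. indicator (A k) \<omega>) = (indicator (\<Union>k\<le>n. A k) \<omega> :: ennreal)"
      using disj by (intro indicator_UN_disjoint[symmetric]) auto
    then have "(\<Sum>k\<le>n. indicator (A k) \<omega> * ennreal (norm (T n \<omega>) powr p))
        = indicator (\<Union>k\<le>n. A k) \<omega> * ennreal (norm (T n \<omega>) powr p)"
      by (simp flip: sum_distrib_right)
    also have "\<dots> \<le> ennreal (norm (T n \<omega>) powr p)"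
      by (auto simp: indicator_def)
    finally show "(\<Sum>k\<le>n. indicator (A k) \<omega> * ennreal (norm (T n \<omega>) powr p)) \<le> ennreal (norm (T n \<omega>) powr p)" .
  qed
  finally show ?thesis
    unfolding Un[symmetric] by (simp add: T_def)
qed

section \<open>Reindexing, centering and truncation\<close>

text \<open>Injectivity makes the singleton blocks \<open>{f j}\<close> disjoint, so grouping into
  blocks applies; each block is then read off at its only coordinate. This serves to shift the
  sequence when tails are estimated.\<close>

lemma indep_vars_inj_reindex:
  assumes "indep_vars (\<lambda>_. N) X UNIV" and "inj f"
  shows "indep_vars (\<lambda>_. N) (\<lambda>i. X (f i)) J"
proof -
  have "indep_vars (\<lambda>j. Pi\<^sub>M {f j} (\<lambda>_. N)) (\<lambda>j \<omega>. restrict (\<lambda>i. X i \<omega>) {f j}) J"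
    using assms by (intro indep_vars_restrict[OF assms(1)]) (auto simp: disjoint_family_on_def inj_def)
  then have "indep_vars (\<lambda>_. N) (\<lambda>j \<omega>. restrict (\<lambda>i. X i \<omega>) {f j} (f j)) J"
    by (rule indep_vars_compose2[where Y = "\<lambda>j v. v (f j)"]) (auto intro: measurable_component_singleton)
  then show ?thesis by simp
qed

text \<open>The constant is \<open>2 powr (p - 1)\<close> from convexity times 2, since by Jensen
  the power of the norm of the mean is at most the moment itself.\<close>

lemma centered_moment_le:
  fixes Y :: "'a \<Rightarrow> 'b::{banach, second_countable_topology}"
  assumes "1 \<le> p" and Y: "integrable M Y" "integrable M (\<lambda>\<omega>. norm (Y \<omega>) powr p)"
  shows "integrable M (\<lambda>\<omega>. norm (Y \<omega> - expectation Y) powr p)"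
    and "expectation (\<lambda>\<omega>. norm (Y \<omega> - expectation Y) powr p)
           \<le> 2 powr p * expectation (\<lambda>\<omega>. norm (Y \<omega>) powr p)"
proof -
  let ?b = "\<lambda>\<omega>. 2 powr (p - 1) * (norm (Y \<omega>) powr p + norm (expectation Y) powr p)"
  have [measurable]: "Y \<in> borel_measurable M" using Y by auto
  have le: "norm (Y \<omega> - expectation Y) powr p \<le> ?b \<omega>" for \<omega>
    using assms norm_triangle_ineq4[of "Y \<omega>" "expectation Y"]
    by (intro order.trans[OF powr_mono2 powr_add_le]) auto
  have b: "integrable M ?b" using Y by simp
  show int: "integrable M (\<lambda>\<omega>. norm (Y \<omega> - expectation Y) powr p)"
    by (rule Bochner_Integration.integrable_bound[OF b]) (use le in auto)
  have mean: "norm (expectation Y) powr p \<le> expectation (\<lambda>\<omega>. norm (Y \<omega>) powr p)"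
    using norm_expectation_powr_le[OF assms(1) Y(1)]
    unfolding nn_integral_eq_integral[OF Y(2) AE_I2[OF powr_ge_zero]]
    by (subst (asm) ennreal_le_iff) auto
  have "expectation (\<lambda>\<omega>. norm (Y \<omega> - expectation Y) powr p) \<le> expectation ?b"
    by (intro integral_mono int b le)
  also have "\<dots> = 2 powr (p - 1) * (expectation (\<lambda>\<omega>. norm (Y \<omega>) powr p) + norm (expectation Y) powr p)"
    using Y by (simp add: prob_space)
  also have "\<dots> \<le> 2 powr (p - 1) * (expectation (\<lambda>\<omega>. norm (Y \<omega>) powr p) + expectation (\<lambda>\<omega>. norm (Y \<omega>) powr p))"
    by (intro mult_left_mono add_left_mono mean) simp
  finally show "expectation (\<lambda>\<omega>. norm (Y \<omega> - expectation Y) powr p)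
      \<le> 2 powr p * expectation (\<lambda>\<omega>. norm (Y \<omega>) powr p)"
    by (simp add: powr_diff)
qed

text \<open>If a partial sum reaches \<epsilon>, its truncated or its large part reaches
  \<epsilon>/2. For the truncated part, \<open>4 powr p\<close> collects one factor
  \<open>2 powr p\<close> from halving \<epsilon> and one from centering, and \<open>C\<close> comes
  from type \<open>p\<close>. For the large part, 4 likewise is 2 from halving times 2 from
  centering. The maximum is a common constant for both.\<close>

lemma maximal_inequality_phi0:
  fixes X :: "nat \<Rightarrow> 'a \<Rightarrow> 'b::{banach, second_countable_topology}"
  assumes p: "1 \<le> p" and C: "0 < C" "type_constant TYPE('b) p C" and e: "0 < \<epsilon>"
    and ind: "indep_vars (\<lambda>_. borel) X {..n}"
    and X: "\<And>i. i \<le> n \<Longrightarrow> integrable M (X i)" "\<And>i. i \<le> n \<Longrightarrow> expectation (X i) = 0"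
  shows "prob {\<omega> \<in> space M. \<exists>k\<le>n. \<epsilon> \<le> norm (\<Sum>i\<le>k. X i \<omega>)}
       \<le> max (4 / \<epsilon>) (4 powr p * C / \<epsilon> powr p) * (\<Sum>i\<le>n. expectation (\<lambda>\<omega>. phi0 p (norm (X i \<omega>))))"
proof -
  have Xm: "X i \<in> borel_measurable M" if "i \<le> n" for i
    using X(1)[OF that] by auto
  define y z :: "'b \<Rightarrow> 'b" where "y x = (if norm x \<le> 1 then x else 0)" and "z x = (if norm x \<le> 1 then 0 else x)" for x
  have [measurable]: "y \<in> borel_measurable borel" "z \<in> borel_measurable borel"
    unfolding y_def z_def by measurable
  have yz: "y x + z x = x" for x by (auto simp: y_def z_def)
  have yle: "norm (y x) \<le> 1" "norm (y x) \<le> norm x" for x by (auto simp: y_def)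
  have yp: "norm (y x) powr p \<le> 1" for x using powr_mono2[of p "norm (y x)" 1] yle[of x] p by simp
  have zle: "norm (z x) \<le> norm x" for x by (auto simp: z_def)
  \<comment> \<open>The truncation level is where \<open>phi0\<close> changes from power to
    identity, so for each \<open>x\<close> one summand is \<open>phi0\<close> and the other is
    0.\<close>
  have phi: "phi0 p (norm x) = norm (y x) powr p + norm (z x)" for x
    using p by (auto simp: phi0_def y_def z_def)
  define Y Z where "Y i \<omega> = y (X i \<omega>)" and "Z i \<omega> = z (X i \<omega>)" for i \<omega>
  define W where "W i \<omega> = Y i \<omega> - expectation (Y i)" for i \<omega>
  \<comment> \<open>Running over all \<open>i \<le> n\<close>, \<open>Q\<close> dominates the
    centered large parts of every partial sum at once, so one use of Markov's inequality covers all
    \<open>k\<close>.\<close>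
  define Q where "Q \<omega> = (\<Sum>i\<le>n. norm (Z i \<omega>) + norm (expectation (Z i)))" for \<omega>
  have Ym: "Y i \<in> borel_measurable M" and Zm: "Z i \<in> borel_measurable M" if "i \<le> n" for i
    using Xm[OF that] unfolding Y_def Z_def by measurable
  have Y: "integrable M (Y i)" and Z: "integrable M (Z i)"
    and Yp: "integrable M (\<lambda>\<omega>. norm (Y i \<omega>) powr p)" if "i \<le> n" for i
  proof -
    note [measurable] = Ym[OF that] Zm[OF that]
    show "integrable M (Y i)"
      by (rule Bochner_Integration.integrable_bound[OF X(1)[OF that]]) (auto simp: Y_def yle)
    show "integrable M (Z i)"
      by (rule Bochner_Integration.integrable_bound[OF X(1)[OF that]]) (auto simp: Z_def zle)
    show "integrable M (\<lambda>\<omega>. norm (Y i \<omega>) powr p)"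
    proof (rule integrable_const_bound)
      show "AE \<omega> in M. norm (norm (Y i \<omega>) powr p) \<le> 1" by (simp add: Y_def yp)
    qed measurable
  qed
  \<comment> \<open>As \<open>X i\<close> has mean 0, the two centerings cancel and
    \<open>X i\<close> is exactly the sum of the centered parts.\<close>
  have EYZ: "expectation (Y i) + expectation (Z i) = 0" if "i \<le> n" for i
  proof -
    have "expectation (Y i) + expectation (Z i) = expectation (\<lambda>\<omega>. Y i \<omega> + Z i \<omega>)"
      using Y[OF that] Z[OF that] by simp
    then show ?thesis using X(2)[OF that] by (simp add: Y_def Z_def yz)
  qed
  have W: "integrable M (W i)" "expectation (W i) = 0" if "i \<le> n" for i
    using Y[OF that] unfolding W_def by (auto simp: prob_space)
  have Wp: "integrable M (\<lambda>\<omega>. norm (W i \<omega>) powr p)"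
    "expectation (\<lambda>\<omega>. norm (W i \<omega>) powr p) \<le> 2 powr p * expectation (\<lambda>\<omega>. norm (Y i \<omega>) powr p)" if "i \<le> n" for i
    using centered_moment_le[OF p Y[OF that] Yp[OF that]] unfolding W_def by auto
  have indW: "indep_vars (\<lambda>_. borel) W {..n}"
    unfolding W_def Y_def by (rule indep_vars_compose2[OF ind]) measurable
  let ?y = "\<Sum>i\<le>n. expectation (\<lambda>\<omega>. norm (Y i \<omega>) powr p)" and ?z = "\<Sum>i\<le>n. expectation (\<lambda>\<omega>. norm (Z i \<omega>))"
  let ?A = "{\<omega> \<in> space M. \<exists>k\<le>n. \<epsilon> / 2 \<le> norm (\<Sum>i\<le>k. W i \<omega>)}" and ?B = "{\<omega> \<in> space M. \<epsilon> / 2 \<le> Q \<omega>}"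
  have Wm: "W i \<in> borel_measurable M" if "i \<le> n" for i using W[OF that] by auto
  have A: "?A \<in> sets M"
  proof -
    have "(\<lambda>\<omega>. norm (\<Sum>i\<le>k. W i \<omega>)) \<in> borel_measurable M" if "k \<le> n" for k
      using that by (intro borel_measurable_norm[THEN measurable_compose[rotated]] borel_measurable_sum Wm) auto
    then have "{\<omega> \<in> space M. \<exists>k\<in>{..n}. \<epsilon> / 2 \<le> norm (\<Sum>i\<le>k. W i \<omega>)} \<in> sets M"
      by (intro sets.sets_Collect_finite_Ex) (auto intro!: borel_measurable_le)
    also have "{\<omega> \<in> space M. \<exists>k\<in>{..n}. \<epsilon> / 2 \<le> norm (\<Sum>i\<le>k. W i \<omega>)} = ?A"
      by blast
    finally show ?thesis .
  qed
  have Q: "integrable M Q" unfolding Q_def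
    by (intro Bochner_Integration.integrable_sum Bochner_Integration.integrable_add integrable_norm Z) auto
  have B: "?B \<in> sets M" using borel_measurable_integrable[OF Q] by measurable
  have sub: "{\<omega> \<in> space M. \<exists>k\<le>n. \<epsilon> \<le> norm (\<Sum>i\<le>k. X i \<omega>)} \<subseteq> ?A \<union> ?B"
  proof safe
    fix \<omega> k assume k: "k \<le> n" "\<epsilon> \<le> norm (\<Sum>i\<le>k. X i \<omega>)" "\<omega> \<in> space M" "\<not> \<epsilon> / 2 \<le> Q \<omega>"
    have "X i \<omega> = W i \<omega> + (Z i \<omega> - expectation (Z i))" if "i \<le> k" for i
      using EYZ[of i] yz[of "X i \<omega>"] that k(1) unfolding W_def Y_def Z_def
      by (simp add: algebra_simps add_eq_0_iff)
    then have eq: "(\<Sum>i\<le>k. X i \<omega>) = (\<Sum>i\<le>k. W i \<omega>) + (\<Sum>i\<le>k. Z i \<omega> - expectation (Z i))"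
      by (simp flip: sum.distrib)
    have "norm (\<Sum>i\<le>k. Z i \<omega> - expectation (Z i)) \<le> (\<Sum>i\<le>k. norm (Z i \<omega>) + norm (expectation (Z i)))"
      by (intro sum_norm_le norm_triangle_ineq4)
    moreover have "(\<Sum>i\<le>k. norm (Z i \<omega>) + norm (expectation (Z i))) \<le> Q \<omega>"
      unfolding Q_def using k(1) by (intro sum_mono2) auto
    ultimately have "norm (\<Sum>i\<le>k. X i \<omega>) \<le> norm (\<Sum>i\<le>k. W i \<omega>) + Q \<omega>"
      unfolding eq by (intro norm_triangle_le) linarith
    then show "\<exists>k\<le>n. \<epsilon> / 2 \<le> norm (\<Sum>i\<le>k. W i \<omega>)"
      using k by (intro exI[of _ k]) auto
  qed
  have "prob ?A \<le> 4 powr p * C / \<epsilon> powr p * ?y"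
  proof -
    \<comment> \<open>Truncation makes the \<open>W i\<close> bounded, hence the moment finite; this
      turns the \<open>ennreal\<close> bound into one on real expectations, to which type
      \<open>p\<close> applies.\<close>
    have Wsum: "integrable M (\<lambda>\<omega>. norm (\<Sum>i\<le>n. W i \<omega>) powr p)"
    proof (rule integrable_const_bound[of _ "(\<Sum>i\<le>n. 1 + norm (expectation (Y i))) powr p"])
      have "norm (\<Sum>i\<le>n. W i \<omega>) \<le> (\<Sum>i\<le>n. 1 + norm (expectation (Y i)))" for \<omega>
        unfolding W_def Y_def
        by (intro sum_norm_le order.trans[OF norm_triangle_ineq4] add_right_mono yle)
      then show "AE \<omega> in M. norm (norm (\<Sum>i\<le>n. W i \<omega>) powr p) \<le> (\<Sum>i\<le>n. 1 + norm (expectation (Y i))) powr p"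
        using p by (auto intro!: powr_mono2)
      have [measurable]: "(\<lambda>\<omega>. \<Sum>i\<le>n. W i \<omega>) \<in> borel_measurable M"
        by (intro borel_measurable_sum Wm) auto
      show "(\<lambda>\<omega>. norm (\<Sum>i\<le>n. W i \<omega>) powr p) \<in> borel_measurable M"
        by measurable
    qed
    have "ennreal ((\<epsilon> / 2) powr p * prob ?A) \<le> (\<integral>\<^sup>+\<omega>. ennreal (norm (\<Sum>i\<le>n. W i \<omega>) powr p) \<partial>M)"
      using maximal_inequality_norm_powr[OF p _ indW W, of "\<epsilon> / 2"] e
      by (simp add: emeasure_eq_measure ennreal_mult)
    also have "\<dots> = ennreal (expectation (\<lambda>\<omega>. norm (\<Sum>i\<le>n. W i \<omega>) powr p))"
      by (intro nn_integral_eq_integral Wsum) auto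
    finally have "(\<epsilon> / 2) powr p * prob ?A \<le> expectation (\<lambda>\<omega>. norm (\<Sum>i\<le>n. W i \<omega>) powr p)"
      by (subst (asm) ennreal_le_iff) auto
    also have "\<dots> \<le> C * (\<Sum>i\<le>n. expectation (\<lambda>\<omega>. norm (W i \<omega>) powr p))"
      by (rule type_constantD[OF C(2) indW W Wp(1)])
    also have "\<dots> \<le> C * (\<Sum>i\<le>n. 2 powr p * expectation (\<lambda>\<omega>. norm (Y i \<omega>) powr p))"
      using C by (intro mult_left_mono sum_mono Wp(2)) auto
    finally have "(\<epsilon> / 2) powr p * prob ?A \<le> C * 2 powr p * ?y"
      by (simp add: sum_distrib_left mult.assoc)
    moreover have "(4::real) powr p = 2 powr p * 2 powr p"
      by (simp flip: powr_mult)
    moreover have "\<epsilon> powr p > 0" using e by simp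
    ultimately show ?thesis
      using e by (simp add: powr_divide field_simps)
  qed
  moreover have "prob ?B \<le> 4 / \<epsilon> * ?z"
  proof -
    have "expectation Q = (\<Sum>i\<le>n. expectation (\<lambda>\<omega>. norm (Z i \<omega>)) + norm (expectation (Z i)))"
      unfolding Q_def using Z by (subst Bochner_Integration.integral_sum)
        (auto simp: prob_space intro!: Bochner_Integration.integrable_add)
    also have "\<dots> \<le> (\<Sum>i\<le>n. expectation (\<lambda>\<omega>. norm (Z i \<omega>)) + expectation (\<lambda>\<omega>. norm (Z i \<omega>)))"
      by (intro sum_mono add_left_mono integral_norm_bound)
    also have "\<dots> = 2 * ?z" by (simp add: sum_distrib_left)
    finally have "expectation Q / (\<epsilon> / 2) \<le> 2 * ?z / (\<epsilon> / 2)"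
      using e by (intro divide_right_mono) auto
    moreover have "prob ?B \<le> expectation Q / (\<epsilon> / 2)"
      by (rule integral_Markov_inequality_measure[OF Q, of "{}"])
        (use e in \<open>auto simp: Q_def intro!: sum_nonneg\<close>)
    ultimately show ?thesis by simp
  qed
  moreover have "prob {\<omega> \<in> space M. \<exists>k\<le>n. \<epsilon> \<le> norm (\<Sum>i\<le>k. X i \<omega>)} \<le> prob ?A + prob ?B"
    by (rule order.trans[OF finite_measure_mono[OF sub sets.Un[OF A B]] measure_Un_le[OF A B]])
  moreover have sum_phi: "(\<Sum>i\<le>n. expectation (\<lambda>\<omega>. phi0 p (norm (X i \<omega>)))) = ?y + ?z"
  proof -
    have "(\<Sum>i\<le>n. expectation (\<lambda>\<omega>. phi0 p (norm (X i \<omega>))))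
        = (\<Sum>i\<le>n. expectation (\<lambda>\<omega>. norm (Y i \<omega>) powr p) + expectation (\<lambda>\<omega>. norm (Z i \<omega>)))"
      unfolding phi Y_def[symmetric] Z_def[symmetric]
      by (intro sum.cong refl Bochner_Integration.integral_add Yp integrable_norm Z) auto
    then show ?thesis by (simp add: sum.distrib)
  qed
  moreover have "0 \<le> ?y" "0 \<le> ?z" by (auto intro!: sum_nonneg)
  then have "4 / \<epsilon> * ?z \<le> max (4 / \<epsilon>) (4 powr p * C / \<epsilon> powr p) * ?z"
    "4 powr p * C / \<epsilon> powr p * ?y \<le> max (4 / \<epsilon>) (4 powr p * C / \<epsilon> powr p) * ?y"
    by - (intro mult_right_mono max.cobounded1 max.cobounded2; assumption)+
  ultimately show ?thesis
    unfolding sum_phi distrib_left by linarith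
qed

section \<open>Tails and almost sure convergence\<close>

text \<open>Starting the sequence at \<open>Suc N\<close> turns increments after \<open>N\<close>
  into partial sums of an independent sequence, to which the maximal inequality applies.\<close>

lemma tail_maximal_inequality_phi0:
  fixes X :: "nat \<Rightarrow> 'a \<Rightarrow> 'b::{banach, second_countable_topology}"
  assumes "1 \<le> p" "0 < C" "type_constant TYPE('b) p C" "0 < \<epsilon>"
    and ind: "indep_vars (\<lambda>_. borel) X UNIV"
    and X: "\<And>i. integrable M (X i)" "\<And>i. expectation (X i) = 0"
  defines "t \<equiv> \<lambda>n. \<Sum>i\<le>n. expectation (\<lambda>\<omega>. phi0 p (norm (X i \<omega>)))"
  shows "prob {\<omega> \<in> space M. \<exists>k\<le>m. \<epsilon> \<le> norm ((\<Sum>i\<le>Suc N + k. X i \<omega>) - (\<Sum>i\<le>N. X i \<omega>))}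
       \<le> max (4 / \<epsilon>) (4 powr p * C / \<epsilon> powr p) * (t (Suc N + m) - t N)"
proof -
  \<comment> \<open>Polymorphic in the values: it rewrites both the increments of the vectors and
    the real difference of \<open>t\<close>.\<close>
  have shift: "(\<Sum>i\<le>Suc N + k. f i) - (\<Sum>i\<le>N. f i) = (\<Sum>i\<le>k. f (Suc N + i))" for f :: "nat \<Rightarrow> 'c::ab_group_add" and k
    by (induction k) (auto simp: algebra_simps)
  have "indep_vars (\<lambda>_. borel) (\<lambda>i. X (Suc N + i)) {..m}"
    by (rule indep_vars_inj_reindex[OF ind]) (auto simp: inj_def)
  from maximal_inequality_phi0[OF assms(1-4) this X] show ?thesis
    unfolding t_def shift .
qed

text \<open>The bound on increments is uniform in the horizon \<open>m\<close>, so it survives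
  \<open>m \<rightarrow> \<infinity>\<close>. Choosing \<open>N\<close> far out in the Cauchy
  sequence \<open>t\<close> makes it arbitrarily small, and completeness of the space turns Cauchy
  paths into convergent ones.\<close>

lemma AE_convergent_sum_phi0:
  fixes X :: "nat \<Rightarrow> 'a \<Rightarrow> 'b::{banach, second_countable_topology}"
  assumes "1 \<le> p" "0 < C" "type_constant TYPE('b) p C"
    and ind: "indep_vars (\<lambda>_. borel) X UNIV"
    and X: "\<And>i. integrable M (X i)" "\<And>i. expectation (X i) = 0"
    and conv: "convergent (\<lambda>n. \<Sum>i\<le>n. expectation (\<lambda>\<omega>. phi0 p (norm (X i \<omega>))))"
  shows "AE \<omega> in M. convergent (\<lambda>n. \<Sum>i\<le>n. X i \<omega>)"
proof -
  define t where "t n = (\<Sum>i\<le>n. expectation (\<lambda>\<omega>. phi0 p (norm (X i \<omega>))))" for n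
  define S where "S n \<omega> = (\<Sum>i\<le>n. X i \<omega>)" for n \<omega>
  have [measurable]: "X i \<in> borel_measurable M" for i using X(1)[of i] by auto
  have [measurable]: "S n \<in> borel_measurable M" for n unfolding S_def by measurable
  have ae: "AE \<omega> in M. \<exists>N. \<forall>k. norm (S (Suc N + k) \<omega> - S N \<omega>) < \<epsilon>" if e: "\<epsilon> > 0" for \<epsilon> :: real
  proof -
    define L where "L = max (4 / \<epsilon>) (4 powr p * C / \<epsilon> powr p)"
    have L: "L > 0" using e by (simp add: L_def less_max_iff_disj)
    define A where "A N m = {\<omega> \<in> space M. \<exists>k\<le>m. \<epsilon> \<le> norm (S (Suc N + k) \<omega> - S N \<omega>)}" for N m
    define D where "D = {\<omega> \<in> space M. \<forall>N. \<exists>k. \<epsilon> \<le> norm (S (Suc N + k) \<omega> - S N \<omega>)}"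
    have [measurable]: "A N m \<in> sets M" "D \<in> sets M" for N m
      unfolding A_def D_def by measurable
    have "prob D \<le> r" if r: "r > 0" for r :: real
    proof -
      have "Cauchy t" using conv unfolding t_def by (rule convergent_Cauchy)
      moreover have "r / L > 0" using r L by simp
      ultimately obtain N where N: "\<forall>m\<ge>N. \<forall>n\<ge>N. norm (t m - t n) < r / L"
        using CauchyD by blast
      have "prob (A N m) \<le> r" for m
      proof -
        have "prob (A N m) \<le> L * (t (Suc N + m) - t N)"
          unfolding A_def S_def t_def L_def
          by (rule tail_maximal_inequality_phi0[OF assms(1-3) e ind X])
        also have "\<dots> \<le> L * (r / L)"
          using N[rule_format, of "Suc N + m" N] L by (intro mult_left_mono) auto
        finally show ?thesis using L by simp
      qed
      \<comment> \<open>Continuity from below: \<open>A N m\<close> increases with \<open>m\<close>,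
        and its union contains \<open>D\<close> whatever \<open>N\<close> is.\<close>
      moreover have "(\<lambda>m. prob (A N m)) \<longlonglongrightarrow> prob (\<Union>m. A N m)"
        by (intro finite_Lim_measure_incseq) (auto simp: incseq_def A_def intro: order.trans)
      ultimately have "prob (\<Union>m. A N m) \<le> r" by (intro LIMSEQ_le_const2) auto
      moreover have "prob D \<le> prob (\<Union>m. A N m)"
        by (intro finite_measure_mono) (auto simp: D_def A_def, meson order.refl)
      ultimately show ?thesis by simp
    qed
    then have "prob D = 0"
      by (metis dense_ge measure_nonneg order.antisym)
    then have "AE \<omega> in M. \<omega> \<notin> D"
      by (intro AE_not_in) (simp add: null_sets_def emeasure_eq_measure)
    then show ?thesis
      by (rule AE_mp) (auto intro!: AE_I2 simp: D_def not_le)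
  qed
  \<comment> \<open>Countably many precisions suffice, so the exceptional null sets can be
    merged.\<close>
  have "AE \<omega> in M. \<forall>j. \<exists>N. \<forall>k. norm (S (Suc N + k) \<omega> - S N \<omega>) < inverse (of_nat (Suc j))"
    unfolding AE_all_countable by (intro allI ae) simp
  then show ?thesis
  proof (rule AE_mp, intro AE_I2 impI)
    fix \<omega> assume *: "\<forall>j. \<exists>N. \<forall>k. norm (S (Suc N + k) \<omega> - S N \<omega>) < inverse (of_nat (Suc j))"
    have "Cauchy (\<lambda>n. S n \<omega>)"
      unfolding Cauchy_altdef2
    proof (intro allI impI)
      fix e :: real assume e: "0 < e"
      then obtain j where j: "inverse (of_nat (Suc j)) < e" using reals_Archimedean by blast
      from * obtain N where N: "norm (S (Suc N + k) \<omega> - S N \<omega>) < inverse (of_nat (Suc j))" for k by blast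
      have "dist (S n \<omega>) (S N \<omega>) < e" if "N \<le> n" for n
      proof (cases "n = N")
        case False
        then have "n = Suc N + (n - Suc N)" using that by simp
        then show ?thesis using N[of "n - Suc N"] j by (simp add: dist_norm)
      qed (use e in simp)
      then show "\<exists>N. \<forall>n\<ge>N. dist (S n \<omega>) (S N \<omega>) < e" by blast
    qed
    then show "convergent (\<lambda>n. \<Sum>i\<le>n. X i \<omega>)"
      unfolding S_def by (rule Cauchy_convergent)
  qed
qed

end

section \<open>From the tail bound to the rate\<close>

text \<open>The first entry of the minimum times \<open>4 / \<epsilon>\<close> is exactly
  \<open>2 / 3 * \<delta>\<close>. The second entry times
  \<open>4 powr p * C / \<epsilon> powr p\<close> is that value divided by \<open>2 powr p\<close>,
  because \<open>2 powr (3 * p - 1)\<close> is half of \<open>4 powr p * 2 powr p\<close>.\<close>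

lemma eps_tilde_bound:
  assumes "0 < p" "0 < C" "0 < \<epsilon>" "0 < \<delta>"
  shows "0 < eps_tilde p C \<epsilon> \<delta>"
    and "max (4 / \<epsilon>) (4 powr p * C / \<epsilon> powr p) * eps_tilde p C \<epsilon> \<delta> \<le> 2 / 3 * \<delta>"
proof -
  let ?\<eta> = "eps_tilde p C \<epsilon> \<delta>"
  show pos: "0 < ?\<eta>"
    using assms by (simp add: eps_tilde_def)
  have "?\<eta> \<le> \<epsilon> * \<delta> / 6" unfolding eps_tilde_def by (intro Min_le) auto
  then have "4 / \<epsilon> * ?\<eta> \<le> 4 / \<epsilon> * (\<epsilon> * \<delta> / 6)"
    using assms by (intro mult_left_mono) auto
  then have 1: "4 / \<epsilon> * ?\<eta> \<le> 2 / 3 * \<delta>" using assms by simp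
  have two: "2 powr (3 * p - 1) = 4 powr p * 2 powr p / (2::real)" "(1::real) \<le> 2 powr p"
  proof -
    have "(4::real) powr p = 2 powr (2 * p)" by (simp add: powr_powr[symmetric])
    then show "2 powr (3 * p - 1) = 4 powr p * 2 powr p / (2::real)"
      by (simp add: powr_diff flip: powr_add)
  qed (use assms in \<open>simp add: ge_one_powr_ge_zero\<close>)
  have "?\<eta> \<le> \<delta> * \<epsilon> powr p / (2 powr (3 * p - 1) * (3 * C))"
    unfolding eps_tilde_def by (intro Min_le) auto
  then have "4 powr p * C / \<epsilon> powr p * ?\<eta>
      \<le> 4 powr p * C / \<epsilon> powr p * (\<delta> * \<epsilon> powr p / (2 powr (3 * p - 1) * (3 * C)))"
    using assms by (intro mult_left_mono) auto
  also have "\<dots> = 2 / 3 * \<delta> / 2 powr p"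
    using assms unfolding two by (simp add: field_simps)
  also have "\<dots> \<le> 2 / 3 * \<delta> / 1"
    using two(2) assms by (intro divide_left_mono) auto
  finally have "4 powr p * C / \<epsilon> powr p * ?\<eta> \<le> 2 / 3 * \<delta>" by simp
  with 1 show "max (4 / \<epsilon>) (4 powr p * C / \<epsilon> powr p) * ?\<eta> \<le> 2 / 3 * \<delta>"
    by (simp add: max_def)
qed

theorem theorem4p11:
  fixes M :: "'a measure"
    and X :: "nat \<Rightarrow> 'a \<Rightarrow> 'b::{banach, second_countable_topology}"
    and p C :: real
    and \<Phi> :: "real \<Rightarrow> (nat \<Rightarrow> nat) \<Rightarrow> nat"
  assumes "1 \<le> p" and "p \<le> 2"
    and "rademacher_type TYPE('b) p"
    and "0 < C" and "type_constant TYPE('b) p C"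
    and "prob_space M"
    and "prob_space.indep_vars M (\<lambda>_. borel) X UNIV"
    and "\<And>n. integrable M (X n)"
    and "\<And>n. integral\<^sup>L M (X n) = 0"
    and "convergent (\<lambda>n. \<Sum>i\<le>n. \<integral>\<omega>. phi0 p (norm (X i \<omega>)) \<partial>M)"
    and "cauchy_metastability_rate \<Phi> (\<lambda>n. \<Sum>i\<le>n. \<integral>\<omega>. phi0 p (norm (X i \<omega>)) \<partial>M)"
  shows "(AE \<omega> in M. convergent (\<lambda>n. \<Sum>i\<le>n. X i \<omega>)) \<and>
         metastable_as_rate M (\<lambda>\<epsilon> \<delta> K. \<Phi> (eps_tilde p C \<epsilon> \<delta>) K) (\<lambda>n \<omega>. \<Sum>i\<le>n. X i \<omega>)"
proof
  interpret prob_space M by fact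
  note X = \<open>1 \<le> p\<close> \<open>0 < C\<close> \<open>type_constant TYPE('b) p C\<close>
  show "AE \<omega> in M. convergent (\<lambda>n. \<Sum>i\<le>n. X i \<omega>)"
    by (rule AE_convergent_sum_phi0[OF X]) fact+
  show "metastable_as_rate M (\<lambda>\<epsilon> \<delta> K. \<Phi> (eps_tilde p C \<epsilon> \<delta>) K) (\<lambda>n \<omega>. \<Sum>i\<le>n. X i \<omega>)"
    unfolding metastable_as_rate_def
  proof (intro allI impI)
    fix \<epsilon> \<delta> :: real and K :: "nat \<Rightarrow> nat"
    assume e: "0 < \<epsilon>" and d: "0 < \<delta>"
    define t where "t n = (\<Sum>i\<le>n. expectation (\<lambda>\<omega>. phi0 p (norm (X i \<omega>))))" for n
    let ?S = "\<lambda>n \<omega>. \<Sum>i\<le>n. X i \<omega>" and ?\<eta> = "eps_tilde p C \<epsilon> \<delta>"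
    let ?L = "max (4 / \<epsilon>) (4 powr p * C / \<epsilon> powr p)"
    have "0 < p" using \<open>1 \<le> p\<close> by simp
    note \<eta> = eps_tilde_bound[OF this \<open>0 < C\<close> e d]
    \<comment> \<open>Metastability of \<open>t\<close> is used with the window function
      \<open>K\<close> itself, so the index it provides is already the one required.\<close>
    obtain N where N: "N \<le> \<Phi> ?\<eta> K"
      "\<And>n m. n \<in> {N..N + K N} \<Longrightarrow> m \<in> {N..N + K N} \<Longrightarrow> \<bar>t n - t m\<bar> < ?\<eta>"
      using assms(11) \<eta>(1) unfolding cauchy_metastability_rate_def t_def[symmetric] by metis
    let ?E = "{\<omega> \<in> space M. (MAX n\<in>{N..N + K N}. norm (?S N \<omega> - ?S n \<omega>)) \<ge> \<epsilon>}"
    have E: "?E = {\<omega> \<in> space M. \<exists>n\<in>{N..N + K N}. \<epsilon> \<le> norm (?S N \<omega> - ?S n \<omega>)}"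
      by (subst Max_ge_iff) auto
    have "prob ?E < \<delta>"
    \<comment> \<open>The tail inequality covers at least one increment. An empty window extension
      is therefore separate: only \<open>n = N\<close> remains, where the difference is 0, below
      \<epsilon>.\<close>
    proof (cases "K N")
      case 0
      then have "?E = {}" using e unfolding E by simp
      then show ?thesis using d by (simp only: measure_empty)
    next
      case (Suc m)
      have E': "?E = {\<omega> \<in> space M. \<exists>k\<le>m. \<epsilon> \<le> norm (?S (Suc N + k) \<omega> - ?S N \<omega>)}"
        unfolding E
      proof (intro Collect_cong conj_cong refl iffI)
        fix \<omega> assume "\<exists>n\<in>{N..N + K N}. \<epsilon> \<le> norm (?S N \<omega> - ?S n \<omega>)"
        then obtain n where n: "N \<le> n" "n \<le> N + Suc m" "\<epsilon> \<le> norm (?S N \<omega> - ?S n \<omega>)"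
          unfolding Suc by auto
        then have "n \<noteq> N" using e by auto
        with n show "\<exists>k\<le>m. \<epsilon> \<le> norm (?S (Suc N + k) \<omega> - ?S N \<omega>)"
          by (intro exI[of _ "n - Suc N"]) (auto simp: norm_minus_commute)
      next
        fix \<omega> assume "\<exists>k\<le>m. \<epsilon> \<le> norm (?S (Suc N + k) \<omega> - ?S N \<omega>)"
        then obtain k where "k \<le> m" "\<epsilon> \<le> norm (?S (Suc N + k) \<omega> - ?S N \<omega>)" by blast
        then show "\<exists>n\<in>{N..N + K N}. \<epsilon> \<le> norm (?S N \<omega> - ?S n \<omega>)"
          unfolding Suc by (intro bexI[of _ "Suc N + k"]) (subst norm_minus_commute, auto)
      qed
      have "prob ?E \<le> ?L * (t (Suc N + m) - t N)"
        unfolding t_def E' by (rule tail_maximal_inequality_phi0[OF X e]) fact+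
      also have "\<dots> \<le> ?L * ?\<eta>"
        using N(2)[of "Suc N + m" N] Suc e by (intro mult_left_mono) (auto simp: le_max_iff_disj)
      \<comment> \<open>The strict bound required of the rate comes from the factor 2/3.\<close>
      also have "\<dots> \<le> 2 / 3 * \<delta>" by (rule \<eta>(2))
      also have "\<dots> < \<delta>" using d by simp
      finally show ?thesis .
    qed
    with N(1) show "\<exists>N\<le>\<Phi> ?\<eta> K. prob {\<omega> \<in> space M. (MAX n\<in>{N..N + K N}. norm (?S N \<omega> - ?S n \<omega>)) \<ge> \<epsilon>} < \<delta>"
      by blast
  qed
qed

end
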